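(* Let $n\ge 1$ and let $Q_n$ be the $n$-cube with vertex set $V_n=\{(\epsilon_1,\dots,\epsilon_n): \epsilon_i\in\{-1,1\}\}$. A $2$-coloring of $Q_n$ assigns to each vertex either black (weight $1$) or white (weight $0$); it is balanced if the sum of the black vertices, viewed as vectors in $\mathbb{R}^n$, is the zero vector (a coloring with no black vertices is also balanced). Two vertices $v,-v$ form an antipodal pair. For $k\ge 0$ and $i\ge 0$, let $\mathcal{B}_{n,2k,i}$ be the set of balanced $2$-colorings of $Q_n$ with exactly $2k$ black vertices containing exactly $i$ antipodal pairs of black vertices (i.e. exactly $i$ pairs $\{v,-v\}$ with both $v$ and $-v$ black). Then \[ (2^{n-1}-2k+i)\,|\mathcal{B}_{n,2k,i}|=(i+1)\,|\mathcal{B}_{n,2k+2,i+1}| \] for all $0\le i\le k$ and $1\le k\le 2^{n-2}-1$.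
   Context: Balanced means the center of mass $\frac{1}{w}\sum v$ (sum over black vertices $v$, $w$ the number of black vertices) equals the origin, with the convention that the empty coloring has center of mass at the origin. *)

theory Defs
  imports "HOL-Analysis.Analysis"
begin

text \<open>The dimension \<open>n \<ge> 1\<close> is \<open>CARD('n)\<close> for an arbitrary finite index type \<open>'n\<close>.\<close>

definition cube_vertices :: "(real ^ 'n) set" where
  "cube_vertices = {v. \<forall>j. v $ j \<in> {-1, 1}}"

text \<open>A colouring is its weight function (black = 1, white = 0). It is extensional
  (undefined off the cube), so that distinct functions are distinct colourings and
  cardinalities count colourings.\<close>

definition two_colorings :: "(real ^ 'n \<Rightarrow> nat) set" where
  "two_colorings = cube_vertices \<rightarrow>\<^sub>E {0, 1}"

definition black_vertices :: "(real ^ 'n \<Rightarrow> nat) \<Rightarrow> (real ^ 'n) set" where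
  "black_vertices c = {v \<in> cube_vertices. c v = 1}"

definition balanced :: "(real ^ 'n \<Rightarrow> nat) \<Rightarrow> bool" where
  "balanced c \<longleftrightarrow> (\<Sum>v\<in>black_vertices c. v) = 0"

definition black_antipodal_pairs :: "(real ^ 'n \<Rightarrow> nat) \<Rightarrow> (real ^ 'n) set set" where
  "black_antipodal_pairs c =
     {{v, - v} |v. v \<in> black_vertices c \<and> - v \<in> black_vertices c}"

definition balanced_colorings :: "nat \<Rightarrow> nat \<Rightarrow> (real ^ 'n \<Rightarrow> nat) set" where
  "balanced_colorings m i =
     {c \<in> two_colorings. balanced c \<and> card (black_vertices c) = m \<and>
        card (black_antipodal_pairs c) = i}"

end

theory Submission
  imports Defs
begin

text \<open>Count the pairs \<open>(B, p)\<close> of a balanced black set \<open>B\<close> and an antipodal pair \<open>p\<close> disjoint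
  from it. Since \<open>p\<close> sums to zero, \<open>(B, p) \<mapsto> (B \<union> p, p)\<close> is a bijection onto the pairs of a
  balanced set with two more vertices and one of its own antipodal pairs. A set of \<open>m\<close> vertices
  containing \<open>i\<close> antipodal pairs meets \<open>m - i\<close> of the \<open>2^(n-1)\<close> pairs, so each \<open>B\<close>
  occurs \<open>2^(n-1) - m + i\<close> times on the left.\<close>

text \<open>Abstracts from the cube: \<open>A\<close> stands for the family of antipodal pairs, and
  a colouring is replaced by its black set. The counting uses only that \<open>A\<close> consists of
  finitely many disjoint two-element sets with sum zero.\<close>

definition zero_sum_sets :: "'a::comm_monoid_add set set \<Rightarrow> nat \<Rightarrow> nat \<Rightarrow> 'a set set" where
  "zero_sum_sets A m i =
     {B. B \<subseteq> \<Union>A \<and> \<Sum>B = 0 \<and> card B = m \<and> card {p \<in> A. p \<subseteq> B} = i}"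

text \<open>A two-element set \<open>p\<close> meets \<open>B\<close> in 0, 1 or 2 points, which is
  1, plus 1 if \<open>p\<close> lies inside \<open>B\<close>, minus 1 if \<open>p\<close> misses
  \<open>B\<close>. Summing over \<open>A\<close> gives \<open>card B\<close>, since the disjoint
  members of \<open>A\<close> cover \<open>B\<close>.\<close>

lemma card_disjoint_pairs:
  assumes "finite A" and "disjoint A" and "\<And>p. p \<in> A \<Longrightarrow> card p = 2" and "B \<subseteq> \<Union>A"
  shows "int (card {p \<in> A. p \<inter> B = {}}) = int (card A) - int (card B) + int (card {p \<in> A. p \<subseteq> B})"
proof -
  have fin: "finite p" if "p \<in> A" for p
    using assms(3)[OF that] card.infinite by fastforce
  have "B = (\<Union>p\<in>A. p \<inter> B)"
    using assms(4) by auto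
  moreover have "card (\<Union>p\<in>A. p \<inter> B) = (\<Sum>p\<in>A. card (p \<inter> B))"
    using assms(1,2) fin by (intro card_UN_disjoint) (auto simp: disjoint_def)
  ultimately have "int (card B) = (\<Sum>p\<in>A. int (card (p \<inter> B)))"
    by simp
  also have "\<dots> = (\<Sum>p\<in>A. 1 + of_bool (p \<subseteq> B) - of_bool (p \<inter> B = {}))"
  proof (intro sum.cong refl)
    fix p assume "p \<in> A"
    then obtain x y where "p = {x, y}" "x \<noteq> y"
      using assms(3) by (meson card_2_iff)
    then show "int (card (p \<inter> B)) = 1 + of_bool (p \<subseteq> B) - of_bool (p \<inter> B = {})"
      by (cases "x \<in> B"; cases "y \<in> B") (auto simp: Int_insert_left)
  qed
  also have "\<dots> = int (card A) + int (card {p \<in> A. p \<subseteq> B}) - int (card {p \<in> A. p \<inter> B = {}})"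
    using assms(1) by (simp add: sum.distrib sum_subtractf sum.If_cases of_bool_def Int_def)
  finally show ?thesis
    by simp
qed

text \<open>A member of \<open>A\<close> other than \<open>p\<close> is disjoint from
  \<open>p\<close>, so inside \<open>B \<union> p\<close> it already lies in \<open>B\<close>. Hence
  adjoining \<open>p\<close> raises the number of contained pairs by exactly one.\<close>

lemma pairs_within_union:
  assumes "disjoint A" and "p \<in> A" and "p \<noteq> {}" and "{} \<notin> A" and "p \<inter> B = {}"
  shows "{q \<in> A. q \<subseteq> B \<union> p} = insert p {q \<in> A. q \<subseteq> B}"
    and "p \<notin> {q \<in> A. q \<subseteq> B}"
proof -
  show "p \<notin> {q \<in> A. q \<subseteq> B}"
    using assms by auto
  have "q \<subseteq> B" if "q \<in> A" "q \<subseteq> B \<union> p" "q \<noteq> p" for q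
  proof -
    have "q \<inter> p = {}"
      using assms(1,2) that by (auto simp: disjoint_def)
    then show ?thesis
      using that by auto
  qed
  then show "{q \<in> A. q \<subseteq> B \<union> p} = insert p {q \<in> A. q \<subseteq> B}"
    using assms by auto
qed

text \<open>Adjoining \<open>p\<close> adds two elements, nothing to the sum, and one contained
  pair. The equivalence serves both the bijection of the double count and its inverse.\<close>

lemma zero_sum_sets_union_iff:
  assumes "finite A" and "disjoint A" and "\<And>p. p \<in> A \<Longrightarrow> card p = 2"
    and "\<And>p. p \<in> A \<Longrightarrow> \<Sum>p = 0"
    and "p \<in> A" and "B \<inter> p = {}"
  shows "B \<union> p \<in> zero_sum_sets A (m + 2) (i + 1) \<longleftrightarrow> B \<in> zero_sum_sets A m i"
\<comment> \<open>Outside \<open>\<Union>A\<close> both memberships fail; inside it \<open>B\<close>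
  is finite, as the laws for \<open>card\<close> and sums of disjoint unions require.\<close>
proof (cases "B \<subseteq> \<Union>A")
  case False
  then show ?thesis
    by (auto simp: zero_sum_sets_def)
next
  case True
  have fin: "finite q" if "q \<in> A" for q
    using assms(3)[OF that] card.infinite by fastforce
  have "finite B"
    using True fin assms(1) by (meson finite_Union finite_subset)
  then have "card (B \<union> p) = card B + 2" "\<Sum>(B \<union> p) = \<Sum>B"
    using assms fin by (simp_all add: card_Un_disjoint sum.union_disjoint)
  moreover have "p \<noteq> {}" "{} \<notin> A"
    using assms(3,5) by force+
  then have "card {q \<in> A. q \<subseteq> B \<union> p} = card {q \<in> A. q \<subseteq> B} + 1"
    using pairs_within_union[OF assms(2,5), of B] assms(1,6)
    by (simp add: Int_commute)
  ultimately show ?thesis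
    using True assms(5) by (auto simp: zero_sum_sets_def)
qed

lemma finite_zero_sum_sets:
  assumes "finite (\<Union>A)"
  shows "finite (zero_sum_sets A m i)"
  by (rule finite_subset[of _ "Pow (\<Union>A)"]) (use assms in \<open>auto simp: zero_sum_sets_def\<close>)

theorem zero_sum_sets_recurrence:
  assumes "finite A" and "disjoint A" and "\<And>p. p \<in> A \<Longrightarrow> card p = 2"
    and "\<And>p. p \<in> A \<Longrightarrow> \<Sum>p = 0"
  shows "(int (card A) - int m + int i) * int (card (zero_sum_sets A m i))
    = (int i + 1) * int (card (zero_sum_sets A (m + 2) (i + 1)))"
proof -
  let ?F = "zero_sum_sets A m i" and ?G = "zero_sum_sets A (m + 2) (i + 1)"
  let ?X = "SIGMA B:?F. {p \<in> A. p \<inter> B = {}}" and ?Y = "SIGMA B:?G. {p \<in> A. p \<subseteq> B}"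
  have "finite (\<Union>A)"
    using assms(1,3) by (metis card.infinite finite_Union zero_neq_numeral)
  note fin = finite_zero_sum_sets[OF this]
  note iff = zero_sum_sets_union_iff[OF assms]
  have "bij_betw (\<lambda>(B, p). (B \<union> p, p)) ?X ?Y"
  proof (rule bij_betw_byWitness[where f' = "\<lambda>(B, p). (B - p, p)"])
    show "(\<lambda>(B, p). (B \<union> p, p)) ` ?X \<subseteq> ?Y"
      using iff by (auto simp: Int_commute)
    \<comment> \<open>The equivalence is read backwards, with \<open>B - p\<close> as the smaller
      set.\<close>
    have "B - p \<in> ?F" if "B \<in> ?G" "p \<in> A" "p \<subseteq> B" for B p
    proof -
      have "(B - p) \<union> p = B"
        using that by auto
      then show ?thesis
        using iff[of p "B - p" m i] that by auto
    qed
    then show "(\<lambda>(B, p). (B - p, p)) ` ?Y \<subseteq> ?X"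
      by auto
  qed auto
  then have "int (card ?X) = int (card ?Y)"
    by (simp add: bij_betw_same_card)
  moreover have "int (card ?X) = (\<Sum>B\<in>?F. int (card {p \<in> A. p \<inter> B = {}}))"
    using fin assms(1) by (simp add: card_SigmaI)
  moreover have "\<dots> = (\<Sum>B\<in>?F. int (card A) - int m + int i)"
    using card_disjoint_pairs[OF assms(1-3)]
    by (intro sum.cong refl) (auto simp: zero_sum_sets_def)
  moreover have "int (card ?Y) = (\<Sum>B\<in>?G. int (card {p \<in> A. p \<subseteq> B}))"
    using fin assms(1) by (simp add: card_SigmaI)
  moreover have "\<dots> = (\<Sum>B\<in>?G. int i + 1)"
    by (intro sum.cong refl) (auto simp: zero_sum_sets_def)
  ultimately show ?thesis
    by (simp add: mult.commute)
qed

definition antipodal_pairs :: "(real ^ 'n) set set" where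
  "antipodal_pairs = (\<lambda>v. {v, - v}) ` cube_vertices"

lemma uminus_in_cube_vertices: "v \<in> cube_vertices \<Longrightarrow> - v \<in> cube_vertices"
  unfolding cube_vertices_def by (simp add: minus_equation_iff[of _ 1]) (metis minus_minus)

lemma card_cube_vertices: "card (cube_vertices :: (real ^ 'n) set) = 2 ^ CARD('n::finite)"
proof -
  have "bij_betw vec_nth (cube_vertices :: (real ^ 'n) set) (UNIV \<rightarrow>\<^sub>E {-1, 1})"
    by (rule bij_betw_byWitness[where f' = vec_lambda])
      (auto simp: cube_vertices_def PiE_iff)
  then show ?thesis
    by (simp add: bij_betw_same_card card_PiE numeral_2_eq_2)
qed

lemma finite_cube_vertices: "finite (cube_vertices :: (real ^ 'n::finite) set)"
  by (rule card_ge_0_finite) (simp add: card_cube_vertices)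

text \<open>A coordinate equal to its own negative would be 0, not 1 or -1. This is what makes every
  antipodal pair have two elements and sum zero.\<close>

lemma cube_vertex_neq_uminus:
  fixes v :: "real ^ 'n::finite"
  assumes "v \<in> cube_vertices"
  shows "v \<noteq> - v"
proof
  assume "v = - v"
  then have "v $ j = - (v $ j)" for j
    by (metis vector_uminus_component)
  then show False
    using assms by (auto simp: cube_vertices_def)
qed

lemma Union_antipodal_pairs: "\<Union>antipodal_pairs = cube_vertices"
  by (auto simp: antipodal_pairs_def uminus_in_cube_vertices)

lemma finite_antipodal_pairs: "finite (antipodal_pairs :: (real ^ 'n::finite) set set)"
  by (simp add: antipodal_pairs_def finite_cube_vertices)

lemma disjoint_antipodal_pairs: "disjoint antipodal_pairs"
  by (auto simp: antipodal_pairs_def disjoint_def)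

lemma card_antipodal_pair: "p \<in> antipodal_pairs \<Longrightarrow> card p = 2"
  using cube_vertex_neq_uminus by (auto simp: antipodal_pairs_def card_2_iff)

lemma sum_antipodal_pair: "p \<in> antipodal_pairs \<Longrightarrow> \<Sum>p = 0"
  using cube_vertex_neq_uminus by (fastforce simp: antipodal_pairs_def)

lemma card_antipodal_pairs:
  "card (antipodal_pairs :: (real ^ 'n) set set) = 2 ^ (CARD('n::finite) - 1)"
proof -
  let ?A = "antipodal_pairs :: (real ^ 'n) set set"
  have "2 * card ?A = card (\<Union>?A)"
    using disjoint_antipodal_pairs
    by (intro card_partition)
      (auto simp: Union_antipodal_pairs finite_cube_vertices finite_antipodal_pairs
        card_antipodal_pair disjoint_def)
  \<comment> \<open>The truncated subtraction is harmless because an index type is nonempty, so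
    \<open>CARD('n)\<close> is at least 1.\<close>
  also have "\<dots> = 2 * 2 ^ (CARD('n) - 1)"
    by (simp add: Union_antipodal_pairs card_cube_vertices flip: power_Suc)
  finally show ?thesis
    by simp
qed

lemma black_antipodal_pairs_eq:
  "black_antipodal_pairs c = {p \<in> antipodal_pairs. p \<subseteq> black_vertices c}"
  by (auto simp: black_antipodal_pairs_def antipodal_pairs_def black_vertices_def)

text \<open>A colouring is determined by its black set. The inverse is the indicator function
  restricted to the cube, undefined elsewhere because colourings are extensional.\<close>

lemma bij_betw_black_vertices:
  "bij_betw black_vertices (balanced_colorings m i) (zero_sum_sets antipodal_pairs m i)"
proof (rule bij_betw_byWitness[where f' = "\<lambda>B. \<lambda>v\<in>cube_vertices. of_bool (v \<in> B)"])
  show "\<forall>c\<in>balanced_colorings m i.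
      (\<lambda>v\<in>cube_vertices. of_bool (v \<in> black_vertices c)) = c"
  proof
    fix c assume "c \<in> balanced_colorings m i"
    then have c: "c \<in> cube_vertices \<rightarrow>\<^sub>E {0, 1}"
      by (simp add: balanced_colorings_def two_colorings_def)
    show "(\<lambda>v\<in>cube_vertices. of_bool (v \<in> black_vertices c)) = c"
    proof
      fix v
      show "(\<lambda>v\<in>cube_vertices. of_bool (v \<in> black_vertices c)) v = c v"
        using c PiE_mem[OF c, of v] PiE_arb[OF c, of v]
        by (cases "v \<in> cube_vertices") (auto simp: black_vertices_def)
    qed
  qed
  \<comment> \<open>Restricting the indicator to the cube loses nothing, since \<open>B\<close> lies
    in the union of the antipodal pairs, which is the cube.\<close>
  have black: "black_vertices (\<lambda>v\<in>cube_vertices. of_bool (v \<in> B)) = B"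
    if "B \<in> zero_sum_sets antipodal_pairs m i" for B
    using that by (auto simp: black_vertices_def zero_sum_sets_def Union_antipodal_pairs)
  then show "\<forall>B\<in>zero_sum_sets antipodal_pairs m i.
      black_vertices (\<lambda>v\<in>cube_vertices. of_bool (v \<in> B)) = B"
    by blast
  show "black_vertices ` balanced_colorings m i \<subseteq> zero_sum_sets antipodal_pairs m i"
    by (auto simp: balanced_colorings_def zero_sum_sets_def balanced_def
        black_antipodal_pairs_eq Union_antipodal_pairs black_vertices_def)
  show "(\<lambda>B. \<lambda>v\<in>cube_vertices. of_bool (v \<in> B)) ` zero_sum_sets antipodal_pairs m i
      \<subseteq> balanced_colorings m i"
  proof (rule image_subsetI)
    fix B
    assume B: "B \<in> zero_sum_sets antipodal_pairs m i"
    have "(\<lambda>v\<in>cube_vertices. of_bool (v \<in> B)) \<in> two_colorings"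
      by (auto simp: two_colorings_def)
    then show "(\<lambda>v\<in>cube_vertices. of_bool (v \<in> B)) \<in> balanced_colorings m i"
      using B black[OF B]
      by (simp add: balanced_colorings_def balanced_def black_antipodal_pairs_eq
          zero_sum_sets_def)
  qed
qed

theorem theorem2p1:
  fixes k i :: nat
  assumes "i \<le> k"
    and "1 \<le> k"
    and "real k \<le> 2 powi (int CARD('n::finite) - 2) - 1"
  shows "(2 ^ (CARD('n) - 1) - 2 * int k + int i)
           * int (card (balanced_colorings (2 * k) i :: (real ^ 'n \<Rightarrow> nat) set))
       = (int i + 1)
           * int (card (balanced_colorings (2 * k + 2) (i + 1) :: (real ^ 'n \<Rightarrow> nat) set))"
  \<comment> \<open>Instance \<open>m = 2 * k\<close> for the antipodal pairs; the bijection turns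
    both cardinalities into counts of colourings, and \<open>card A\<close> becomes
    \<open>2 ^ (CARD('n) - 1)\<close>.\<close>
  using zero_sum_sets_recurrence[of "antipodal_pairs :: (real ^ 'n) set set" "2 * k" i,
      OF finite_antipodal_pairs disjoint_antipodal_pairs card_antipodal_pair sum_antipodal_pair]
  by (simp add: bij_betw_same_card[OF bij_betw_black_vertices] card_antipodal_pairs)

end
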